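(* Consider the problem (P): $\min_x\{f_1(x): f_2(x)\le 0\}$ with $f_1(x)=\frac12x^\top Q_1x+b_1^\top x$, $f_2(x)=\frac12x^\top Q_2x+b_2^\top x+c$, where $Q_1,Q_2$ are real symmetric $n\times n$ matrices, $b_1,b_2\in\mathbb{R}^n$, $c\in\mathbb{R}$. Assume that there is a point $x$ with $f_2(x)<0$, that $f_1$ and $f_2$ are not both convex, that $\mathrm{Null}(Q_1)\cap\mathrm{Null}(Q_2)=\{0\}$, and that $I_{PSD}:=\{\lambda\ge 0: Q_1+\lambda Q_2\succeq 0\}$ is nonempty. Then: 1. If $I_{PSD}=[\lambda_1,\lambda_2]$ with $\lambda_1<\lambda_2$, then, with $h_i(x)=f_1(x)+\lambda_if_2(x)$ for $i=1,2$, problem (P) is equivalent to the convex quadratic problem $$(\mathrm{P}_1)\quad \min_{x,t}\{t:\ h_1(x)\le t,\ h_2(x)\le t\}.$$ 2. If $I_{PSD}=[\lambda_3,\infty)$, then, with $h_3(x)=f_1(x)+\lambda_3f_2(x)$, problem (P) is equivalent to the convex quadratic problem $$(\mathrm{P}_2)\quad \min_{x,t}\{t:\ h_3(x)\le t,\ f_2(x)\le 0\}=\min_x\{h_3(x):\ f_2(x)\le 0\}.$$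
   Context: $A\succeq 0$ means that the symmetric matrix $A$ is positive semidefinite. "Equivalent" means that the two problems have the same optimal value (infimum): $v(\mathrm{P})=v(\mathrm{P}_1)$ in item 1 and $v(\mathrm{P})=v(\mathrm{P}_2)$ in item 2. *)

theory Defs
  imports "HOL-Analysis.Analysis"
begin

definition psd :: "real^'n^'n \<Rightarrow> bool" where
  "psd A \<longleftrightarrow> transpose A = A \<and> (\<forall>x. 0 \<le> x \<bullet> (A *v x))"

definition I_PSD :: "real^'n^'n \<Rightarrow> real^'n^'n \<Rightarrow> real set" where
  "I_PSD Q1 Q2 = {l. 0 \<le> l \<and> psd (Q1 + l *\<^sub>R Q2)}"

(* The infimum is taken in the extended reals: it is -\<infinity> for a problem that is
   unbounded below and \<infinity> for an infeasible one, and need not be attained. *)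
definition optval :: "('a \<Rightarrow> real) \<Rightarrow> 'a set \<Rightarrow> ereal" where
  "optval f S = (INF x\<in>S. ereal (f x))"

end

theory Submission
  imports Defs
begin

text \<open>
  Along a direction \<open>d\<close> in the kernel of \<open>Q\<^sub>1 + \<lambda>Q\<^sub>2\<close> the Lagrangian
  \<open>h = f\<^sub>1 + \<lambda>f\<^sub>2\<close> is affine, so it does not increase along \<open>d\<close> or along \<open>-d\<close>. If \<open>\<lambda>\<close> is an
  end point of \<open>I_PSD\<close> that is not cut off by \<open>\<lambda> \<ge> 0\<close>, such a \<open>d \<noteq> 0\<close> exists, since positive
  definiteness is an open condition. If \<open>I_PSD\<close> contains a second point \<open>\<mu>\<close>, then
  \<open>d \<bullet> Q\<^sub>2 d\<close> has the sign of \<open>\<mu> - \<lambda>\<close>: it cannot vanish, because \<open>d\<close> would then lie in both kernels.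
  So from any \<open>x\<close> where \<open>f\<^sub>2 x\<close> has the opposite sign one can move along \<open>\<plusminus>d\<close> to a point
  with \<open>f\<^sub>2 = 0\<close>, where \<open>f\<^sub>1 = h\<close> is at most \<open>h x\<close>.
\<close>

section \<open>Quadratic functions and their expansion along lines\<close>

definition quad :: "real^'n^'n \<Rightarrow> real^'n \<Rightarrow> real \<Rightarrow> real^'n \<Rightarrow> real" where
  "quad A b k x = 1/2 * (x \<bullet> (A *v x)) + b \<bullet> x + k"

lemma symmetric_inner_commute:
  fixes A :: "real^'n^'n"
  assumes "transpose A = A"
  shows "x \<bullet> (A *v y) = y \<bullet> (A *v x)"
  by (metis assms dot_lmul_matrix inner_commute transpose_matrix_vector)

lemma transpose_add_scaleR:
  fixes A B :: "real^'n^'n"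
  shows "transpose (A + s *\<^sub>R B) = transpose A + s *\<^sub>R transpose B"
  by (simp add: transpose_def vec_eq_iff)

lemma mult_add_scaleR_vec:
  fixes A B :: "real^'n^'n"
  shows "(A + s *\<^sub>R B) *v x = A *v x + s *\<^sub>R (B *v x)"
  by (simp add: matrix_vector_mult_add_rdistrib scaleR_matrix_vector_assoc[symmetric])

text \<open>The constant term in \<open>quad\<close> closes the family under Lagrangian
  combinations, so one expansion formula serves objective, constraint and Lagrangian.\<close>

lemma quad_add_scaleR:
  "quad A b k x + s * quad B b' k' x = quad (A + s *\<^sub>R B) (b + s *\<^sub>R b') (k + s * k') x"
  unfolding quad_def mult_add_scaleR_vec by (simp add: algebra_simps)

text \<open>Symmetry of \<open>A\<close> merges the two cross terms. Convexity and motion along a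
  line thereby become questions about a polynomial in \<open>t\<close>.\<close>

lemma quad_shift:
  fixes A :: "real^'n^'n"
  assumes "transpose A = A"
  shows "quad A b k (x + t *\<^sub>R d)
    = quad A b k x + t * (d \<bullet> (A *v x) + b \<bullet> d) + t\<^sup>2 * (1/2 * (d \<bullet> (A *v d)))"
  using symmetric_inner_commute[OF assms, of x d]
  by (simp add: quad_def matrix_vector_right_distrib matrix_vector_mult_scaleR
      algebra_simps power2_eq_square)

lemma convex_on_quad:
  fixes A :: "real^'n^'n"
  assumes "psd A"
  shows "convex_on UNIV (quad A b k)"
proof (rule convex_onI)
  fix t :: real and x y :: "real^'n"
  assume t: "0 < t" "t < 1"
  have sym: "transpose A = A" and nn: "0 \<le> (y - x) \<bullet> (A *v (y - x))"
    using assms by (auto simp: psd_def)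
  have pt: "(1 - t) *\<^sub>R x + t *\<^sub>R y = x + t *\<^sub>R (y - x)"
    by (simp add: algebra_simps)
  define p q where "p = (y - x) \<bullet> (A *v x) + b \<bullet> (y - x)" and "q = (y - x) \<bullet> (A *v (y - x))"
  have "quad A b k y = quad A b k x + p + 1/2 * q"
    using quad_shift[OF sym, of b k x 1 "y - x"] by (simp add: p_def q_def)
  moreover have "quad A b k ((1 - t) *\<^sub>R x + t *\<^sub>R y) = quad A b k x + t * p + t\<^sup>2 * (1/2 * q)"
    unfolding pt p_def q_def by (rule quad_shift[OF sym])
  \<comment> \<open>Only this is left for convexity: the affine terms cancel, and
    \<open>t^2 <= t\<close> on the unit interval.\<close>
  moreover have "t\<^sup>2 * (1/2 * q) \<le> t * (1/2 * q)"
    using t nn by (intro mult_right_mono) (auto simp: q_def power2_eq_square mult_left_le)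
  ultimately show "quad A b k ((1 - t) *\<^sub>R x + t *\<^sub>R y) \<le> (1 - t) * quad A b k x + t * quad A b k y"
    by (simp add: algebra_simps)
qed auto

section \<open>Positive semidefinite forms\<close>

lemma psd_inner_eq_0_imp_kernel:
  fixes A :: "real^'n^'n"
  assumes "psd A" "x \<bullet> (A *v x) = 0"
  shows "A *v x = 0"
proof (rule ccontr)
  assume "A *v x \<noteq> 0"
  define y where "y = A *v x"
  define n q where "n = y \<bullet> y" and "q = y \<bullet> (A *v y)"
  have n: "n > 0" using \<open>A *v x \<noteq> 0\<close> by (simp add: y_def n_def)
  have q: "q \<ge> 0" using assms(1) by (simp add: psd_def q_def)
  \<comment> \<open>Half the form, followed from its zero \<open>x\<close> along \<open>y\<close>,
    has slope \<open>n > 0\<close>, so it would be negative for small negative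
    \<open>t\<close>.\<close>
  have "0 \<le> quad A 0 0 (x + t *\<^sub>R y)" for t
    using assms(1) by (simp add: psd_def quad_def)
  moreover have "quad A 0 0 (x + t *\<^sub>R y) = t * n + t\<^sup>2 * (1/2 * q)" for t
    using assms by (subst quad_shift) (auto simp: psd_def quad_def n_def q_def y_def)
  ultimately have "0 \<le> t * n + t\<^sup>2 * (1/2 * q)" for t
    by simp
  \<comment> \<open>Minimising over \<open>t\<close> suggests \<open>- n / q\<close>; the
    \<open>+ 1\<close> also covers \<open>q = 0\<close>, and the factor clears denominators.\<close>
  from this[of "- n / (q + 1)"] have "0 \<le> (- n / (q + 1) * n + (- n / (q + 1))\<^sup>2 * (1/2 * q)) * (q + 1)\<^sup>2"
    by (intro mult_nonneg_nonneg) auto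
  also have "\<dots> = - n\<^sup>2 * (q / 2 + 1)"
    using q by (simp add: divide_simps power2_eq_square) (simp add: algebra_simps)
  also have "\<dots> < 0" using n q by simp
  finally show False by simp
qed

text \<open>On the compact unit sphere the form of \<open>A\<close> has a positive minimum
  \<open>m\<close> and that of \<open>B\<close> is bounded by \<open>K\<close>; homogeneity extends
  the estimate to all \<open>x\<close>. The \<open>+ 1\<close> in the radius
  \<open>m / (K + 1)\<close> guards against \<open>K = 0\<close>.\<close>

lemma posdef_perturb_psd:
  fixes A B :: "real^'n^'n"
  assumes sym: "transpose A = A" "transpose B = B"
    and pos: "\<And>x. x \<noteq> 0 \<Longrightarrow> 0 < x \<bullet> (A *v x)"
  shows "\<exists>e>0. \<forall>s. \<bar>s\<bar> < e \<longrightarrow> psd (A + s *\<^sub>R B)"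
proof -
  let ?S = "sphere (0::real^'n) 1"
  have cont: "continuous_on ?S (\<lambda>x. x \<bullet> (M *v x))" for M :: "real^'n^'n"
    by (intro continuous_intros linear_continuous_on matrix_vector_mul_bounded_linear)
  have ne: "?S \<noteq> {}" by simp
  obtain z where z: "z \<in> ?S" "\<forall>x\<in>?S. z \<bullet> (A *v z) \<le> x \<bullet> (A *v x)"
    using continuous_attains_inf[OF compact_sphere ne cont] by blast
  obtain w where w: "w \<in> ?S" "\<forall>x\<in>?S. \<bar>x \<bullet> (B *v x)\<bar> \<le> \<bar>w \<bullet> (B *v w)\<bar>"
    using continuous_attains_sup[OF compact_sphere ne continuous_on_rabs[OF cont]] by blast
  define m K where "m = z \<bullet> (A *v z)" and "K = \<bar>w \<bullet> (B *v w)\<bar>"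
  have m: "m > 0" using pos[of z] z(1) by (cases "z = 0") (auto simp: m_def)
  have K: "K \<ge> 0" by (simp add: K_def)
  have "psd (A + s *\<^sub>R B)" if s: "\<bar>s\<bar> < m / (K + 1)" for s
    unfolding psd_def
  proof (intro conjI allI)
    show "transpose (A + s *\<^sub>R B) = A + s *\<^sub>R B"
      by (simp add: transpose_add_scaleR sym)
    fix x :: "real^'n"
    show "0 \<le> x \<bullet> ((A + s *\<^sub>R B) *v x)"
    proof (cases "x = 0")
      case False
      define u where "u = x /\<^sub>R norm x"
      have u: "u \<in> ?S" and x: "x = norm x *\<^sub>R u" using False by (simp_all add: u_def)
      have "\<bar>s * (u \<bullet> (B *v u))\<bar> \<le> \<bar>s\<bar> * K"
        using w(2) u by (auto simp: abs_mult K_def intro: mult_left_mono)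
      also have "\<dots> \<le> \<bar>s\<bar> * (K + 1)" by (simp add: algebra_simps)
      also have "\<dots> \<le> m" using s K by (simp add: field_simps)
      also have "m \<le> u \<bullet> (A *v u)" using z(2) u by (simp add: m_def)
      finally have "0 \<le> u \<bullet> ((A + s *\<^sub>R B) *v u)"
        by (simp add: mult_add_scaleR_vec inner_add_right)
      then have "0 \<le> norm x * (norm x * (u \<bullet> ((A + s *\<^sub>R B) *v u)))"
        by simp
      also have "\<dots> = x \<bullet> ((A + s *\<^sub>R B) *v x)"
        by (subst (3 4) x) (simp add: matrix_vector_mult_scaleR)
      finally show ?thesis .
    qed simp
  qed
  moreover have "m / (K + 1) > 0" using m K by simp
  ultimately show ?thesis by blast
qed

section \<open>Moving along kernel directions to the zero set of the constraint\<close>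

lemma quadratic_nonneg_root:
  fixes a b k :: real
  assumes "a * k < 0"
  shows "\<exists>t\<ge>0. k + t * b + t\<^sup>2 * a = 0"
proof -
  \<comment> \<open>The product \<open>k / a\<close> of the roots is negative, so the larger root is
    the one sought. The sign of \<open>t\<close> matters because the Lagrangian is only known not to
    increase in the forward direction.\<close>
  have pos: "\<exists>t\<ge>0. k + t * b + t\<^sup>2 * a = 0" if "a > 0" "k < 0" for a b k :: real
  proof -
    define s where "s = sqrt (b\<^sup>2 - 4 * a * k)"
    have d: "b\<^sup>2 \<le> b\<^sup>2 - 4 * a * k" using mult_pos_neg[OF that] by simp
    then have "\<bar>b\<bar> \<le> s" unfolding s_def by (intro real_le_rsqrt) simp
    then have "0 \<le> (s - b) / (2 * a)" using that by simp
    moreover have "s\<^sup>2 = b\<^sup>2 - 4 * a * k" unfolding s_def using order_trans[OF zero_le_power2 d] by (rule real_sqrt_pow2)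
    then have k: "k = (b\<^sup>2 - s\<^sup>2) / (4 * a)"
      using that by (simp add: field_simps)
    have "k + (s - b) / (2 * a) * b + ((s - b) / (2 * a))\<^sup>2 * a = 0"
      unfolding k using that by (simp add: field_simps power2_eq_square)
    ultimately show ?thesis by blast
  qed
  consider "a > 0" "k < 0" | "-a > 0" "-k < 0"
    using assms by (auto simp: mult_less_0_iff)
  then show ?thesis
  proof cases
    case 2
    then obtain t where "t \<ge> 0" "- k + t * (- b) + t\<^sup>2 * (- a) = 0" using pos by blast
    then show ?thesis by (intro exI[of _ t]) simp
  qed (use pos in blast)
qed

text \<open>On the kernel of \<open>Q1 + l Q2\<close> the form of \<open>Q1 + m Q2\<close> equals
  \<open>m - l\<close> times that of \<open>Q2\<close>, which fixes the sign. Keeping the factor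
  \<open>m - l\<close> lets one statement serve both end points.\<close>

lemma kernel_direction_at_boundary:
  fixes Q1 Q2 :: "real^'n^'n"
  assumes sym: "transpose Q2 = Q2"
    and null: "{x. Q1 *v x = 0} \<inter> {x. Q2 *v x = 0} = {0}"
    and l: "psd (Q1 + l *\<^sub>R Q2)" and m: "psd (Q1 + m *\<^sub>R Q2)"
    and boundary: "\<And>e. e > 0 \<Longrightarrow> \<exists>s. \<bar>s\<bar> < e \<and> \<not> psd (Q1 + (l + s) *\<^sub>R Q2)"
    and "m \<noteq> l"
  obtains d where "(Q1 + l *\<^sub>R Q2) *v d = 0" "(m - l) * (d \<bullet> (Q2 *v d)) > 0"
proof -
  have shift: "Q1 + (l + s) *\<^sub>R Q2 = (Q1 + l *\<^sub>R Q2) + s *\<^sub>R Q2" for s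
    by (simp add: algebra_simps)
  have nn: "0 \<le> x \<bullet> ((Q1 + l *\<^sub>R Q2) *v x)" for x
    using l by (simp add: psd_def)
  have "\<exists>d. d \<noteq> 0 \<and> d \<bullet> ((Q1 + l *\<^sub>R Q2) *v d) = 0"
  proof (rule ccontr)
    assume "\<not> ?thesis"
    then have "0 < x \<bullet> ((Q1 + l *\<^sub>R Q2) *v x)" if "x \<noteq> 0" for x
      using nn[of x] that by (metis less_eq_real_def)
    then have "\<exists>e>0. \<forall>s. \<bar>s\<bar> < e \<longrightarrow> psd (Q1 + l *\<^sub>R Q2 + s *\<^sub>R Q2)"
      using l sym by (intro posdef_perturb_psd) (auto simp: psd_def)
    with boundary show False by (metis shift)
  qed
  then obtain d where d0: "d \<noteq> 0" and "d \<bullet> ((Q1 + l *\<^sub>R Q2) *v d) = 0" by blast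
  then have ker: "(Q1 + l *\<^sub>R Q2) *v d = 0" using l psd_inner_eq_0_imp_kernel by blast
  have Qm: "(Q1 + m *\<^sub>R Q2) *v d = (m - l) *\<^sub>R (Q2 *v d)"
    using ker by (simp add: mult_add_scaleR_vec scaleR_left_diff_distrib add_eq_0_iff)
  have "d \<bullet> ((Q1 + m *\<^sub>R Q2) *v d) \<ge> 0" using m by (simp add: psd_def)
  moreover have "d \<bullet> ((Q1 + m *\<^sub>R Q2) *v d) \<noteq> 0"
  proof
    assume "d \<bullet> ((Q1 + m *\<^sub>R Q2) *v d) = 0"
    then have "(m - l) *\<^sub>R (Q2 *v d) = 0" using m psd_inner_eq_0_imp_kernel Qm by metis
    then have "Q2 *v d = 0" using \<open>m \<noteq> l\<close> by simp
    moreover from this ker have "Q1 *v d = 0" by (simp add: mult_add_scaleR_vec)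
    ultimately show False using null d0 by blast
  qed
  ultimately have "(m - l) * (d \<bullet> (Q2 *v d)) > 0" unfolding Qm inner_scaleR_right by linarith
  with ker show ?thesis by (rule that)
qed

lemma exists_zero_with_smaller_value:
  fixes Q1 Q2 :: "real^'n^'n"
  assumes sym: "transpose Q2 = Q2"
    and null: "{x. Q1 *v x = 0} \<inter> {x. Q2 *v x = 0} = {0}"
    and l: "psd (Q1 + l *\<^sub>R Q2)" and m: "psd (Q1 + m *\<^sub>R Q2)"
    and boundary: "\<And>e. e > 0 \<Longrightarrow> \<exists>s. \<bar>s\<bar> < e \<and> \<not> psd (Q1 + (l + s) *\<^sub>R Q2)"
    and x: "(m - l) * quad Q2 b2 c x < 0"
  shows "\<exists>y. quad Q2 b2 c y = 0 \<and> quad Q1 b1 k y \<le> quad Q1 b1 k x + l * quad Q2 b2 c x"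
proof -
  have "m \<noteq> l" using x by auto
  with sym null l m boundary obtain d0 where
    d0: "(Q1 + l *\<^sub>R Q2) *v d0 = 0" "(m - l) * (d0 \<bullet> (Q2 *v d0)) > 0"
    by (rule kernel_direction_at_boundary)
  define b where "b = b1 + l *\<^sub>R b2"
  \<comment> \<open>Passing to \<open>- d0\<close> preserves the kernel condition and the quadratic
    form, but can make the slope of the Lagrangian nonpositive.\<close>
  define d where "d = (if b \<bullet> d0 \<le> 0 then d0 else - d0)"
  have ker: "(Q1 + l *\<^sub>R Q2) *v d = 0" and dd: "(m - l) * (d \<bullet> (Q2 *v d)) > 0" and bd: "b \<bullet> d \<le> 0"
    using d0 by (auto simp: d_def matrix_vector_mult_scaleR[of _ "-1" d0, simplified])
  \<comment> \<open>The form has the sign of \<open>m - l\<close>, the constraint value at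
    \<open>x\<close> the opposite one.\<close>
  have "1/2 * (d \<bullet> (Q2 *v d)) * quad Q2 b2 c x < 0"
    using dd x by (auto simp: mult_less_0_iff zero_less_mult_iff)
  then obtain t where t: "t \<ge> 0"
    "quad Q2 b2 c x + t * (d \<bullet> (Q2 *v x) + b2 \<bullet> d) + t\<^sup>2 * (1/2 * (d \<bullet> (Q2 *v d))) = 0"
    using quadratic_nonneg_root by blast
  define y where "y = x + t *\<^sub>R d"
  have zero: "quad Q2 b2 c y = 0" using t(2) by (simp add: y_def quad_shift[OF sym])
  let ?h = "quad (Q1 + l *\<^sub>R Q2) b (k + l * c)"
  have symh: "transpose (Q1 + l *\<^sub>R Q2) = Q1 + l *\<^sub>R Q2" using l by (simp add: psd_def)
  \<comment> \<open>Symmetry moves the matrix onto the kernel vector \<open>d\<close>, so the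
    Lagrangian changes only by \<open>t * (b \<bullet> d)\<close>.\<close>
  have "d \<bullet> ((Q1 + l *\<^sub>R Q2) *v x) = 0"
    using symmetric_inner_commute[OF symh, of d x] ker by simp
  then have "?h y = ?h x + t * (b \<bullet> d)"
    by (simp add: y_def quad_shift[OF symh] ker)
  also have "\<dots> \<le> ?h x" using t(1) bd by (simp add: mult_nonneg_nonpos)
  finally have "quad Q1 b1 k y + l * quad Q2 b2 c y \<le> quad Q1 b1 k x + l * quad Q2 b2 c x"
    by (simp add: quad_add_scaleR b_def)
  with zero show ?thesis by auto
qed

section \<open>The pencil at infinity and the comparison of infima\<close>

lemma psd_if_unbounded_pencil:
  fixes Q1 Q2 :: "real^'n^'n"
  assumes sym: "transpose Q2 = Q2" and psd: "\<And>l. l \<ge> l0 \<Longrightarrow> psd (Q1 + l *\<^sub>R Q2)"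
  shows "psd Q2"
  unfolding psd_def
proof (intro conjI allI sym)
  fix x
  show "0 \<le> x \<bullet> (Q2 *v x)"
  proof (rule ccontr)
    assume neg: "\<not> ?thesis"
    define p q where "p = x \<bullet> (Q1 *v x)" and "q = - (x \<bullet> (Q2 *v x))"
    have q: "q > 0" using neg by (simp add: q_def)
    \<comment> \<open>For large \<open>l\<close> the term with \<open>Q2\<close> dominates:
      \<open>l >= (p + 1) / q\<close> forces \<open>p - l * q <= -1\<close>, and the maximum keeps
      \<open>l\<close> in the given range.\<close>
    define l where "l = max l0 ((p + 1) / q)"
    have "0 \<le> p - l * q"
      using psd[of l] by (simp add: l_def psd_def p_def q_def mult_add_scaleR_vec inner_add_right)
    moreover have "(p + 1) / q * q \<le> l * q" using q by (intro mult_right_mono) (auto simp: l_def)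
    ultimately show False using q by simp
  qed
qed

text \<open>Pointwise domination suffices, so no minimiser has to exist and infinite values need no
  separate case.\<close>

lemma optval_le:
  assumes "\<And>x. x \<in> T \<Longrightarrow> \<exists>y\<in>S. f y \<le> g x"
  shows "optval f S \<le> optval g T"
  unfolding optval_def by (rule INF_mono) (simp add: assms)

text \<open>Membership in \<open>I_PSD\<close> can also fail because \<open>l + s\<close> is
  negative; shrinking \<open>s\<close> below \<open>l\<close> leaves only the loss of
  semidefiniteness.\<close>

lemma I_PSD_boundary:
  assumes "l > 0" and "\<And>e. e > 0 \<Longrightarrow> \<exists>s. \<bar>s\<bar> < e \<and> l + s \<notin> I_PSD Q1 Q2" and "e > 0"
  shows "\<exists>s. \<bar>s\<bar> < e \<and> \<not> psd (Q1 + (l + s) *\<^sub>R Q2)"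
proof -
  obtain s where "\<bar>s\<bar> < min e l" "l + s \<notin> I_PSD Q1 Q2"
    using assms(2)[of "min e l"] assms(1,3) by auto
  then show ?thesis by (intro exI[of _ s]) (auto simp: I_PSD_def)
qed

theorem theorem2p9:
  fixes Q1 Q2 :: "real^'n^'n" and b1 b2 :: "real^'n" and c :: real
    and f1 f2 :: "real^'n \<Rightarrow> real"
  assumes sym: "transpose Q1 = Q1" "transpose Q2 = Q2"
    and f1: "\<And>x. f1 x = 1/2 * (x \<bullet> (Q1 *v x)) + b1 \<bullet> x"
    and f2: "\<And>x. f2 x = 1/2 * (x \<bullet> (Q2 *v x)) + b2 \<bullet> x + c"
    and slater: "\<exists>x. f2 x < 0"
    and nonconvex: "\<not> (convex_on UNIV f1 \<and> convex_on UNIV f2)"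
    and null: "{x. Q1 *v x = 0} \<inter> {x. Q2 *v x = 0} = {0}"
    and nonempty: "I_PSD Q1 Q2 \<noteq> {}"
  shows "(\<forall>l1 l2. l1 < l2 \<and> I_PSD Q1 Q2 = {l1..l2} \<longrightarrow>
            (let h1 = (\<lambda>x. f1 x + l1 * f2 x); h2 = (\<lambda>x. f1 x + l2 * f2 x) in
              convex_on UNIV h1 \<and> convex_on UNIV h2 \<and>
              optval f1 {x. f2 x \<le> 0} = optval (\<lambda>(x, t). t) {(x, t). h1 x \<le> t \<and> h2 x \<le> t})) \<and>
         (\<forall>l3. I_PSD Q1 Q2 = {l3..} \<longrightarrow>
            (let h3 = (\<lambda>x. f1 x + l3 * f2 x) in
              convex_on UNIV h3 \<and> convex_on UNIV f2 \<and>
              optval f1 {x. f2 x \<le> 0} = optval (\<lambda>(x, t). t) {(x, t). h3 x \<le> t \<and> f2 x \<le> 0} \<and>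
              optval (\<lambda>(x, t). t) {(x, t). h3 x \<le> t \<and> f2 x \<le> 0} = optval h3 {x. f2 x \<le> 0}))"
proof -
  have q1: "f1 x = quad Q1 b1 0 x" and q2: "f2 x = quad Q2 b2 c x" for x
    by (simp_all add: f1 f2 quad_def)
  have convex_h: "convex_on UNIV (\<lambda>x. f1 x + l * f2 x)" if "l \<in> I_PSD Q1 Q2" for l
    using that convex_on_quad[of "Q1 + l *\<^sub>R Q2"] by (simp add: q1 q2 quad_add_scaleR I_PSD_def)
  have move: "\<exists>y. f2 y = 0 \<and> f1 y \<le> f1 x + l * f2 x"
    if "l \<in> I_PSD Q1 Q2" "m \<in> I_PSD Q1 Q2" "l > 0" "(m - l) * f2 x < 0"
      "\<And>e. e > 0 \<Longrightarrow> \<exists>s. \<bar>s\<bar> < e \<and> l + s \<notin> I_PSD Q1 Q2" for l m x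
    unfolding q1 q2
    using that(1,2,4) I_PSD_boundary[OF that(3,5)]
    by (intro exists_zero_with_smaller_value[OF sym(2) null, where m = m]) (auto simp: I_PSD_def q2)
  have left: "\<exists>y. f2 y \<le> 0 \<and> f1 y \<le> f1 x + l * f2 x"
    if "l \<in> I_PSD Q1 Q2" "m \<in> I_PSD Q1 Q2" "l < m" "f2 x \<le> 0" "I_PSD Q1 Q2 \<subseteq> {l..}" for l m x
  proof (cases "l = 0 \<or> f2 x = 0")
    \<comment> \<open>An end point \<open>l = 0\<close> may be due only to the condition
      \<open>0 \<le> l\<close> and then offers no kernel direction; but here \<open>l * f2 x\<close>
      vanishes and \<open>x\<close> itself serves.\<close>
    case True
    with that show ?thesis by (intro exI[of _ x]) auto
  next
    case False
    have "\<exists>s. \<bar>s\<bar> < e \<and> l + s \<notin> I_PSD Q1 Q2" if "e > 0" for e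
      using that \<open>I_PSD Q1 Q2 \<subseteq> {l..}\<close> by (intro exI[of _ "- e / 2"]) auto
    moreover have "l > 0" using that(1) False by (auto simp: I_PSD_def)
    moreover have "(m - l) * f2 x < 0" using that False by (simp add: mult_pos_neg)
    ultimately show ?thesis using move[OF that(1,2)] by (metis order_refl)
  qed
  show ?thesis
  proof (intro conjI allI impI)
    fix l1 l2
    assume "l1 < l2 \<and> I_PSD Q1 Q2 = {l1..l2}"
    then have l: "l1 < l2" and I: "I_PSD Q1 Q2 = {l1..l2}" by auto
    have mem: "l1 \<in> I_PSD Q1 Q2" "l2 \<in> I_PSD Q1 Q2" using l by (auto simp: I)
    then have l1: "l1 \<ge> 0" by (simp add: I_PSD_def)
    define h1 h2 where "h1 = (\<lambda>x. f1 x + l1 * f2 x)" and "h2 = (\<lambda>x. f1 x + l2 * f2 x)"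
    \<comment> \<open>Feasible \<open>x\<close> are handled by the left end point through
      \<open>h1\<close>, infeasible ones by the right end point through \<open>h2\<close>.\<close>
    have ex: "\<exists>y. f2 y \<le> 0 \<and> f1 y \<le> max (h1 x) (h2 x)" for x
    proof (cases "f2 x \<le> 0")
      case True
      with left[OF mem l] I show ?thesis by (force simp: h1_def)
    next
      case False
      have "\<exists>s. \<bar>s\<bar> < e \<and> l2 + s \<notin> I_PSD Q1 Q2" if "e > 0" for e
        using that by (intro exI[of _ "e / 2"]) (auto simp: I)
      moreover have "l2 > 0" "(l1 - l2) * f2 x < 0" using l l1 False by (auto simp: mult_neg_pos)
      ultimately obtain y where "f2 y = 0" "f1 y \<le> h2 x"
        using move[OF mem(2,1)] unfolding h2_def by blast
      then show ?thesis by (intro exI[of _ y]) auto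
    qed
    have "optval f1 {x. f2 x \<le> 0} = optval (\<lambda>(x, t). t) {(x, t). h1 x \<le> t \<and> h2 x \<le> t}"
    proof (intro antisym optval_le)
      fix z assume "z \<in> {(x, t). h1 x \<le> t \<and> h2 x \<le> t}"
      then show "\<exists>y\<in>{x. f2 x \<le> 0}. f1 y \<le> (case z of (x, t) \<Rightarrow> t)"
        using ex[of "fst z"] by (auto simp: split_beta)
    next
      fix x assume "x \<in> {x. f2 x \<le> 0}"
      \<comment> \<open>Nonnegative multipliers keep both Lagrangians below \<open>f1\<close> on the
        feasible set, so \<open>(x, f1 x)\<close> is admissible.\<close>
      then have "h1 x \<le> f1 x" "h2 x \<le> f1 x"
        using l l1 by (auto simp: h1_def h2_def mult_nonneg_nonpos)
      then show "\<exists>z\<in>{(x, t). h1 x \<le> t \<and> h2 x \<le> t}. (case z of (x, t) \<Rightarrow> t) \<le> f1 x"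
        by (intro bexI[of _ "(x, f1 x)"]) auto
    qed
    then show "let h1 = (\<lambda>x. f1 x + l1 * f2 x); h2 = (\<lambda>x. f1 x + l2 * f2 x) in
              convex_on UNIV h1 \<and> convex_on UNIV h2 \<and>
              optval f1 {x. f2 x \<le> 0} = optval (\<lambda>(x, t). t) {(x, t). h1 x \<le> t \<and> h2 x \<le> t}"
      using mem convex_h by (simp add: Let_def h1_def h2_def)
  next
    fix l3
    assume I: "I_PSD Q1 Q2 = {l3..}"
    \<comment> \<open>\<open>l3 + 1\<close> supplies the second point of \<open>I_PSD\<close> that
      the kernel argument needs.\<close>
    have mem: "l3 \<in> I_PSD Q1 Q2" "l3 + 1 \<in> I_PSD Q1 Q2" by (auto simp: I)
    then have l3: "l3 \<ge> 0" by (simp add: I_PSD_def)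
    define h3 where "h3 = (\<lambda>x. f1 x + l3 * f2 x)"
    have "psd (Q1 + l *\<^sub>R Q2)" if "l \<ge> l3" for l
      using that I by (auto simp: I_PSD_def)
    then have convex_f2: "convex_on UNIV f2"
      using convex_on_quad psd_if_unbounded_pencil[OF sym(2)] q2 by (metis ext)
    let ?P2 = "optval (\<lambda>(x, t). t) {(x, t). h3 x \<le> t \<and> f2 x \<le> 0}"
    have P2: "?P2 = optval h3 {x. f2 x \<le> 0}"
    proof (intro antisym optval_le)
      fix x assume "x \<in> {x. f2 x \<le> 0}"
      then show "\<exists>z\<in>{(x, t). h3 x \<le> t \<and> f2 x \<le> 0}. (case z of (x, t) \<Rightarrow> t) \<le> h3 x"
        by (intro bexI[of _ "(x, h3 x)"]) auto
    qed auto
    moreover have "optval f1 {x. f2 x \<le> 0} = optval h3 {x. f2 x \<le> 0}"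
    proof (intro antisym optval_le)
      fix x assume "x \<in> {x. f2 x \<le> 0}"
      then show "\<exists>y\<in>{x. f2 x \<le> 0}. f1 y \<le> h3 x"
        using left[OF mem] I by (auto simp: h3_def)
    next
      fix x assume "x \<in> {x. f2 x \<le> 0}"
      then show "\<exists>y\<in>{x. f2 x \<le> 0}. h3 y \<le> f1 x"
        using l3 by (intro bexI[of _ x]) (auto simp: h3_def mult_nonneg_nonpos)
    qed
    ultimately show "let h3 = (\<lambda>x. f1 x + l3 * f2 x) in
              convex_on UNIV h3 \<and> convex_on UNIV f2 \<and>
              optval f1 {x. f2 x \<le> 0} = optval (\<lambda>(x, t). t) {(x, t). h3 x \<le> t \<and> f2 x \<le> 0} \<and>
              optval (\<lambda>(x, t). t) {(x, t). h3 x \<le> t \<and> f2 x \<le> 0} = optval h3 {x. f2 x \<le> 0}"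
      using mem convex_h convex_f2 by (simp add: Let_def h3_def)
  qed
qed

end
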